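(* Let $d$ be a positive integer and $\Delta$ an integer with $\Delta\geq 6.21d$. Every $d$-degenerate graph $G$ with $\Delta(G)\leq \Delta$ has an equitable $\Delta$-coloring.
   Context: All graphs are finite and simple. A graph is $d$-degenerate if every subgraph of it has a vertex of degree at most $d$. $\Delta(G)$ denotes the maximum degree of $G$. An equitable $r$-coloring of a graph is a partition of its vertex set into $r$ independent sets $V_1,\dots,V_r$ (some possibly empty) with $\big||V_i|-|V_j|\big|\leq 1$ for all $i,j$. *)

theory Defs
  imports Complex_Main
begin

definition simple_graph :: "'a set \<Rightarrow> ('a \<Rightarrow> 'a \<Rightarrow> bool) \<Rightarrow> bool" where
  "simple_graph V E \<longleftrightarrow> finite V \<and> (\<forall>u v. E u v \<longrightarrow> u \<in> V \<and> v \<in> V)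
     \<and> (\<forall>u v. E u v \<longrightarrow> E v u) \<and> (\<forall>v. \<not> E v v)"

definition degree :: "'a set \<Rightarrow> ('a \<Rightarrow> 'a \<Rightarrow> bool) \<Rightarrow> 'a \<Rightarrow> nat" where
  "degree V E v = card {u \<in> V. E v u}"

definition subgraph :: "'a set \<Rightarrow> ('a \<Rightarrow> 'a \<Rightarrow> bool) \<Rightarrow> 'a set \<Rightarrow> ('a \<Rightarrow> 'a \<Rightarrow> bool) \<Rightarrow> bool" where
  "subgraph W F V E \<longleftrightarrow> W \<subseteq> V \<and> simple_graph W F \<and> (\<forall>u v. F u v \<longrightarrow> E u v)"

definition degenerate :: "nat \<Rightarrow> 'a set \<Rightarrow> ('a \<Rightarrow> 'a \<Rightarrow> bool) \<Rightarrow> bool" where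
  "degenerate d V E \<longleftrightarrow> (\<forall>W F. subgraph W F V E \<and> W \<noteq> {} \<longrightarrow> (\<exists>v\<in>W. degree W F v \<le> d))"

definition max_degree_le :: "'a set \<Rightarrow> ('a \<Rightarrow> 'a \<Rightarrow> bool) \<Rightarrow> nat \<Rightarrow> bool" where
  "max_degree_le V E D \<longleftrightarrow> (\<forall>v\<in>V. degree V E v \<le> D)"

definition equitable_coloring :: "'a set \<Rightarrow> ('a \<Rightarrow> 'a \<Rightarrow> bool) \<Rightarrow> nat \<Rightarrow> ('a \<Rightarrow> nat) \<Rightarrow> bool" where
  "equitable_coloring V E r c \<longleftrightarrow>
     (\<forall>v\<in>V. c v < r) \<and> (\<forall>u\<in>V. \<forall>v\<in>V. E u v \<longrightarrow> c u \<noteq> c v) \<and>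
     (\<forall>i<r. \<forall>j<r. card {v\<in>V. c v = i} \<le> card {v\<in>V. c v = j} + 1)"

end

theory Submission
  imports Defs "HOL-Library.Multiset" "HOL-Library.Transitive_Closure_Table"
begin

text \<open>
  Vertices are added one at a time, each new vertex \<open>x\<close> having at most \<open>d\<close> neighbours among the
  present ones. Suppose that \<open>x\<close> cannot be accommodated with \<open>k\<close> colors, and let \<open>Z\<close> be a smallest
  class; the others have size \<open>|Z|\<close> or \<open>|Z| + 1\<close>. Write \<open>i \<rightarrow> j\<close> if some vertex of class \<open>i\<close> has no
  neighbour in class \<open>j\<close>. Vertices can be shifted along paths, so \<open>x\<close> has a neighbour in each of
  the \<open>a \<le> d\<close> classes from which a class of size \<open>|Z|\<close> can be reached, and every vertex outside
  these accessible classes has a neighbour in each of them. In particular the set \<open>F\<close> of the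
  \<open>f \<ge> k - d\<close> classes without neighbours of \<open>x\<close> contains no accessible class. A vertex is a solo
  neighbour of \<open>z \<in> Z\<close> if \<open>z\<close> is its only neighbour in \<open>Z\<close>.

  If \<open>y, y'\<close> are nonadjacent solo neighbours of \<open>z\<close> in classes of \<open>F\<close>, and either \<open>y\<close> is the only
  neighbour of \<open>z\<close> in its class or the class of \<open>y\<close> can be reached within \<open>F\<close> from a class without
  neighbours of \<open>z\<close>, then moving \<open>y, y'\<close> into \<open>Z\<close>, \<open>z\<close> out of \<open>Z\<close> and \<open>x\<close> into the class of \<open>y'\<close>
  (after a shift in the second case) gives the coloring. So such solo neighbours form cliques, which
  have at most \<open>d + 1\<close> vertices.

  A set of \<open>p\<close> classes of \<open>F\<close> that no other class of \<open>F\<close> can enter forces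
  \<open>p (f - p) + a f \<le> d (f + a)\<close> by counting edges. Hence \<open>p\<close> or \<open>f - p\<close> is at most
  \<open>T = 1.36 d - 1.15 a\<close>, and the union \<open>R\<close>, the core, of all such sets with at most \<open>T\<close> classes
  again has at most \<open>T\<close> classes. Double counting the edges at \<open>Z\<close> gives \<open>z\<close> with many solo
  neighbours outside \<open>R\<close> and few other neighbours in \<open>F\<close>. If the classes without neighbours of \<open>z\<close>
  reach all of \<open>F - R\<close>, there is a clique of size \<open>d + 2\<close>. Otherwise at most \<open>T\<close> classes of \<open>F\<close>
  avoid \<open>z\<close>, all but few of the others contain two neighbours of \<open>z\<close>, and \<open>z\<close> has degree more than
  \<open>k\<close>.
\<close>

subsection \<open>Degenerate graphs\<close>

lemma degenerate_subset:
  assumes "degenerate d V E" "W \<subseteq> V"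
  shows "degenerate d W E"
proof -
  have "subgraph U F V E" if "subgraph U F W E" for U F
    using that assms(2) by (auto simp: subgraph_def)
  then show ?thesis
    using assms(1) unfolding degenerate_def by blast
qed

lemma degree_mono: "finite V \<Longrightarrow> W \<subseteq> V \<Longrightarrow> degree W E v \<le> degree V E v"
  unfolding degree_def by (intro card_mono) auto

lemma max_degree_le_subset:
  "max_degree_le V E k \<Longrightarrow> finite V \<Longrightarrow> W \<subseteq> V \<Longrightarrow> max_degree_le W E k"
  unfolding max_degree_le_def using degree_mono[of V W E] by (blast intro: le_trans)

lemma one_le_degree_iff: "finite V \<Longrightarrow> 1 \<le> degree V E v \<longleftrightarrow> (\<exists>u\<in>V. E v u)"
  by (auto simp: degree_def Suc_le_eq card_gt_0_iff)

locale undirected_graph =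
  fixes E :: "'a \<Rightarrow> 'a \<Rightarrow> bool"
  assumes sym: "symp E" and irrefl: "irreflp E"
begin

lemma edge_commute: "E u v \<longleftrightarrow> E v u"
  using sym unfolding symp_def by blast

lemma no_loop [simp]: "\<not> E v v"
  using irrefl unfolding irreflp_def by blast

lemma degenerate_obtains_low_degree:
  assumes "degenerate d W E" "finite W" "W \<noteq> {}"
  obtains v where "v \<in> W" "degree W E v \<le> d"
proof -
  let ?F = "\<lambda>u v. u \<in> W \<and> v \<in> W \<and> E u v"
  have "subgraph W ?F W E"
    using assms(2) edge_commute by (auto simp: subgraph_def simple_graph_def)
  then obtain v where "v \<in> W" "degree W ?F v \<le> d"
    using assms unfolding degenerate_def by blast
  moreover from this have "degree W ?F v = degree W E v"
    by (simp add: degree_def)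
  ultimately show thesis
    using that by simp
qed

lemma degenerate_induct [consumes 2, case_names empty insert]:
  assumes "finite S" "degenerate d S E"
    and empty: "P {}"
    and insert: "\<And>S x. \<lbrakk>finite S; x \<notin> S; degenerate d S E; degree S E x \<le> d; P S\<rbrakk> \<Longrightarrow> P (insert x S)"
  shows "P S"
  using assms(1,2)
proof (induction rule: finite_psubset_induct)
  case (psubset S)
  show ?case
  proof (cases "S = {}")
    case False
    then obtain x where x: "x \<in> S" "degree S E x \<le> d"
      using degenerate_obtains_low_degree psubset by blast
    have "degenerate d (S - {x}) E"
      using degenerate_subset[OF psubset.prems] by blast
    moreover from this have "P (S - {x})"
      using psubset.IH x(1) by blast
    moreover have "degree (S - {x}) E x \<le> d"
      using degree_mono[OF psubset.hyps, of "S - {x}" E x] x(2) by simp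
    ultimately have "P (insert x (S - {x}))"
      using psubset.hyps by (intro insert) auto
    then show ?thesis
      using x(1) by (simp add: insert_absorb)
  qed (simp add: empty)
qed

lemma card_oriented_edges_le:
  assumes "finite S" "degenerate d S E"
    and "T \<subseteq> S \<times> S" "\<And>u v. (u, v) \<in> T \<Longrightarrow> E u v \<and> (v, u) \<notin> T"
  shows "card T \<le> d * card S"
  using assms
proof (induction arbitrary: T rule: degenerate_induct)
  case empty
  then show ?case by simp
next
  case (insert S x)
  let ?far = "T \<inter> S \<times> S" and ?near = "T - S \<times> S"
  have "card ?far \<le> d * card S"
    using insert.prems(2) by (intro insert.IH) auto
  moreover have "card ?near \<le> degree S E x"
    unfolding degree_def
  proof (rule surj_card_le)
    show "?near \<subseteq> (\<lambda>u. if (x, u) \<in> T then (x, u) else (u, x)) ` {u \<in> S. E x u}"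
    proof
      fix p assume "p \<in> ?near"
      moreover obtain u v where "p = (u, v)"
        by (cases p)
      ultimately have "u = x \<and> v \<in> S \<or> v = x \<and> u \<in> S" "E u v" "(u, v) \<in> T" "(v, u) \<notin> T"
        using insert.prems no_loop by auto
      then show "p \<in> (\<lambda>u. if (x, u) \<in> T then (x, u) else (u, x)) ` {u \<in> S. E x u}"
        using \<open>p = (u, v)\<close> edge_commute[of u v] by (auto simp: image_iff)
    qed
  qed (use insert.hyps in simp)
  moreover have "card T \<le> card ?far + card ?near"
    using card_Un_le[of ?far ?near] by (simp add: Int_Diff_Un)
  ultimately show ?case
    using insert.hyps by simp
qed

lemma card_seen_colors_le:
  assumes "finite W" "degenerate d W E"
    and seen: "\<And>u j. (u, j) \<in> P \<Longrightarrow> u \<in> W \<and> (\<exists>v\<in>W. E u v \<and> c v = j)"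
    and asym: "\<And>u v. (u, c v) \<in> P \<Longrightarrow> (v, c u) \<notin> P"
  shows "card P \<le> d * card W"
proof -
  obtain g where g: "\<And>u j. (u, j) \<in> P \<Longrightarrow> g u j \<in> W \<and> E u (g u j) \<and> c (g u j) = j"
    using seen by metis
  define T where "T = (\<lambda>(u, j). (u, g u j)) ` P"
  have "inj_on (\<lambda>(u, j). (u, g u j)) P"
    using g by (auto simp: inj_on_def) metis
  then have "card P = card T"
    by (simp add: T_def card_image)
  also have "\<dots> \<le> d * card W"
  proof (rule card_oriented_edges_le[OF assms(1,2)])
    show "T \<subseteq> W \<times> W"
      using g seen by (auto simp: T_def)
    show "E u v \<and> (v, u) \<notin> T" if "(u, v) \<in> T" for u v
      using that g asym by (fastforce simp: T_def)
  qed
  finally show ?thesis .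
qed

lemma card_clique_le:
  assumes "finite Q" "degenerate d Q E" and "\<And>u v. \<lbrakk>u \<in> Q; v \<in> Q; u \<noteq> v\<rbrakk> \<Longrightarrow> E u v"
  shows "card Q \<le> d + 1"
proof (cases "Q = {}")
  case False
  then obtain v where v: "v \<in> Q" "degree Q E v \<le> d"
    using degenerate_obtains_low_degree assms(1,2) by blast
  have "{u \<in> Q. E v u} = Q - {v}"
    using assms(3) v(1) by auto
  then show ?thesis
    using v assms(1) by (simp add: degree_def card_Diff_singleton)
qed simp

lemma card_universal_vertices_le:
  assumes "finite S" "degenerate d S E" "P \<subseteq> S" "d + 1 < card S"
    and adjacent: "\<And>u v. \<lbrakk>u \<in> P; v \<in> S; u \<noteq> v\<rbrakk> \<Longrightarrow> E u v"
  shows "card P \<le> d"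
proof (rule ccontr)
  assume "\<not> card P \<le> d"
  then obtain Q where Q: "Q \<subseteq> P" "card Q = d + 1" "finite Q"
    using obtain_subset_with_card_n[of "d + 1" P] by auto
  then obtain w where w: "w \<in> S" "w \<notin> Q"
    using assms(4) card_mono[of Q S] by fastforce
  have "card (insert w Q) \<le> d + 1"
  proof (rule card_clique_le)
    show "degenerate d (insert w Q) E"
      using Q w assms(3) by (intro degenerate_subset[OF assms(2)]) auto
    show "E u v" if "u \<in> insert w Q" "v \<in> insert w Q" "u \<noteq> v" for u v
      using that adjacent[of u v] adjacent[of v u] edge_commute Q w assms(3) by auto
  qed (use Q in simp)
  with Q w show False by simp
qed

definition solo :: "'a set \<Rightarrow> 'a \<Rightarrow> 'a \<Rightarrow> bool" where
  "solo Z z v \<longleftrightarrow> {w \<in> Z. E v w} = {z}"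

lemma soloD: "solo Z z v \<Longrightarrow> z \<in> Z \<and> E v z \<and> E z v"
  using edge_commute by (auto simp: solo_def)

lemma solo_unique: "solo Z z v \<Longrightarrow> w \<in> Z \<Longrightarrow> E v w \<Longrightarrow> w = z"
  by (auto simp: solo_def)

lemma degree_one_obtains_solo:
  assumes "degree Z E v = 1"
  obtains z where "solo Z z v"
  using assms that by (auto simp: degree_def solo_def card_1_singleton_iff)

lemma card_le_sum_solo:
  assumes "finite Z" "finite W" and seen: "\<And>v. v \<in> W \<Longrightarrow> \<exists>w\<in>Z. E v w"
  shows "card W \<le> (\<Sum>z\<in>Z. card {v \<in> W. solo Z z v}) + (\<Sum>v\<in>W. degree Z E v - 1)"
proof -
  have one_le: "1 \<le> card {z \<in> Z. solo Z z v} + (degree Z E v - 1)" if "v \<in> W" for v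
  proof (cases "degree Z E v = 1")
    case True
    then obtain z where "solo Z z v"
      by (rule degree_one_obtains_solo)
    then have "{z \<in> Z. solo Z z v} \<noteq> {}"
      using soloD by blast
    then show ?thesis
      using assms(1) by (simp add: Suc_le_eq card_gt_0_iff)
  next
    case False
    moreover have "1 \<le> degree Z E v"
      using one_le_degree_iff[OF assms(1)] seen[OF that] by blast
    ultimately show ?thesis by linarith
  qed
  have "(\<Sum>z\<in>Z. card {v \<in> W. solo Z z v}) = (\<Sum>v\<in>W. card {z \<in> Z. solo Z z v})"
    using assms(1,2) by (rule sum_multicount_gen) simp
  moreover have "card W \<le> (\<Sum>v\<in>W. card {z \<in> Z. solo Z z v} + (degree Z E v - 1))"
    using sum_mono[of W "\<lambda>_. 1", OF one_le] by simp
  ultimately show ?thesis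
    by (simp add: sum.distrib)
qed

lemma sum_nonsolo_le:
  assumes "finite Z" "finite W"
  shows "(\<Sum>z\<in>Z. card {v \<in> W. E z v \<and> \<not> solo Z z v}) \<le> 2 * (\<Sum>v\<in>W. degree Z E v - 1)"
proof -
  have nonsolo_le: "card {z \<in> Z. E z v \<and> \<not> solo Z z v} \<le> 2 * (degree Z E v - 1)" for v
  proof (cases "degree Z E v = 1")
    case True
    then obtain z where "solo Z z v"
      by (rule degree_one_obtains_solo)
    then have "{z \<in> Z. E z v \<and> \<not> solo Z z v} = {}"
      using solo_unique edge_commute by blast
    then show ?thesis
      by (metis card.empty zero_le)
  next
    case False
    have "card {z \<in> Z. E z v \<and> \<not> solo Z z v} \<le> degree Z E v"
      unfolding degree_def using assms(1) edge_commute by (intro card_mono) auto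
    with False show ?thesis
      by linarith
  qed
  have "(\<Sum>z\<in>Z. card {v \<in> W. E z v \<and> \<not> solo Z z v}) =
      (\<Sum>v\<in>W. card {z \<in> Z. E z v \<and> \<not> solo Z z v})"
    using assms by (rule sum_multicount_gen) simp
  also have "\<dots> \<le> (\<Sum>v\<in>W. 2 * (degree Z E v - 1))"
    by (intro sum_mono nonsolo_le)
  finally show ?thesis
    by (simp add: sum_distrib_left)
qed

end

subsection \<open>Recoloring\<close>

definition color_class :: "'a set \<Rightarrow> ('a \<Rightarrow> nat) \<Rightarrow> nat \<Rightarrow> 'a set" where
  "color_class X c j = {v \<in> X. c v = j}"

definition color_mset :: "'a set \<Rightarrow> ('a \<Rightarrow> nat) \<Rightarrow> nat multiset" where
  "color_mset X c = image_mset c (mset_set X)"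

lemma count_color_mset:
  assumes "finite X"
  shows "count (color_mset X c) j = card (color_class X c j)"
proof -
  have "color_class X c j = {v \<in> X. j = c v}"
    by (auto simp: color_class_def)
  then show ?thesis
    using assms by (simp add: color_mset_def count_image_mset')
qed

lemma color_mset_insert:
  assumes "finite X" "v \<notin> X"
  shows "color_mset (insert v X) (c(v := j)) = add_mset j (color_mset X c)"
proof -
  have "image_mset (c(v := j)) (mset_set X) = image_mset c (mset_set X)"
    using assms by (intro image_mset_cong) auto
  then show ?thesis
    using assms by (simp add: color_mset_def)
qed

lemma color_mset_update:
  assumes "finite X" "v \<in> X"
  shows "add_mset (c v) (color_mset X (c(v := j))) = add_mset j (color_mset X c)"
proof -
  have "color_mset X (c(v := m)) = add_mset m (color_mset (X - {v}) c)" for m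
    using assms color_mset_insert[of "X - {v}" v c m] by (simp add: insert_absorb)
  from this[of j] this[of "c v"] show ?thesis
    by simp
qed

lemma card_colored_in:
  assumes "finite X" "finite S"
  shows "card {v \<in> X. c v \<in> S} = (\<Sum>j\<in>S. card (color_class X c j))"
proof -
  have "card {v \<in> X. c v \<in> S} = (\<Sum>j\<in>S. card {v \<in> {v \<in> X. c v \<in> S}. c v = j})"
    unfolding card_eq_sum using assms by (intro sum.group[symmetric]) auto
  also have "\<dots> = (\<Sum>j\<in>S. card (color_class X c j))"
    by (intro sum.cong arg_cong[where f = card]) (auto simp: color_class_def)
  finally show ?thesis .
qed

lemma rtranclp_first_hit:
  assumes "r\<^sup>*\<^sup>* i j" "j \<in> Q"
  obtains l where "l \<in> Q" "(\<lambda>a b. r a b \<and> a \<notin> Q)\<^sup>*\<^sup>* i l"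
proof -
  have "\<exists>l\<in>Q. (\<lambda>a b. r a b \<and> a \<notin> Q)\<^sup>*\<^sup>* i l"
    using assms(1)
  proof (induction rule: converse_rtranclp_induct)
    case base
    then show ?case using assms(2) by blast
  next
    case (step a b)
    then show ?case
      by (cases "a \<in> Q") (auto intro: converse_rtranclp_into_rtranclp)
  qed
  with that show thesis by blast
qed

context undirected_graph
begin

definition proper_coloring :: "'a set \<Rightarrow> nat \<Rightarrow> ('a \<Rightarrow> nat) \<Rightarrow> bool" where
  "proper_coloring X k c \<longleftrightarrow> (\<forall>v\<in>X. c v < k) \<and> (\<forall>u\<in>X. \<forall>v\<in>X. E u v \<longrightarrow> c u \<noteq> c v)"

definition free_colors :: "'a set \<Rightarrow> nat \<Rightarrow> ('a \<Rightarrow> nat) \<Rightarrow> 'a \<Rightarrow> nat set" where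
  "free_colors X k c v = {..<k} - c ` {u \<in> X. E v u}"

definition movable :: "'a set \<Rightarrow> nat \<Rightarrow> ('a \<Rightarrow> nat) \<Rightarrow> nat \<Rightarrow> nat \<Rightarrow> bool" where
  "movable X k c i j \<longleftrightarrow> (\<exists>w\<in>color_class X c i. j \<in> free_colors X k c w)"

lemma free_colors_iff: "j \<in> free_colors X k c v \<longleftrightarrow> j < k \<and> (\<forall>u\<in>X. E v u \<longrightarrow> c u \<noteq> j)"
  by (auto simp: free_colors_def)

lemma equitable_coloring_iff:
  assumes "finite X"
  shows "equitable_coloring X E k c \<longleftrightarrow> proper_coloring X k c \<and>
    (\<forall>i<k. \<forall>j<k. count (color_mset X c) i \<le> count (color_mset X c) j + 1)"
  by (simp add: equitable_coloring_def proper_coloring_def count_color_mset[OF assms]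
      color_class_def conj_assoc)

lemma proper_coloring_subset: "proper_coloring X k c \<Longrightarrow> Y \<subseteq> X \<Longrightarrow> proper_coloring Y k c"
  unfolding proper_coloring_def by blast

lemma proper_coloring_insert:
  assumes "proper_coloring X k c" "j \<in> free_colors X k c v"
  shows "proper_coloring (insert v X) k (c(v := j))"
  using assms edge_commute unfolding proper_coloring_def free_colors_def by auto

lemma proper_coloring_update:
  "proper_coloring X k c \<Longrightarrow> v \<in> X \<Longrightarrow> j \<in> free_colors X k c v \<Longrightarrow> proper_coloring X k (c(v := j))"
  using proper_coloring_insert[of X k c j v] by (simp add: insert_absorb)

lemma finite_free_colors: "finite (free_colors X k c v)"
  by (simp add: free_colors_def)

lemma card_free_colors_ge:
  assumes "finite X"
  shows "k \<le> card (free_colors X k c v) + degree X E v"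
proof -
  have "k - card (c ` {u \<in> X. E v u}) \<le> card (free_colors X k c v)"
    unfolding free_colors_def using diff_card_le_card_Diff[of "c ` {u \<in> X. E v u}" "{..<k}"] assms
    by simp
  moreover have "card (c ` {u \<in> X. E v u}) \<le> degree X E v"
    unfolding degree_def using assms by (intro card_image_le) simp
  ultimately show ?thesis by simp
qed

lemma shift_along_path:
  assumes "rtrancl_path r i p j" "distinct (i # p)" "finite X" "proper_coloring X k c"
    and movable: "\<And>a b. r a b \<Longrightarrow> movable X k c a b"
  shows "\<exists>c'. proper_coloring X k c' \<and>
    add_mset i (color_mset X c') = add_mset j (color_mset X c) \<and>
    (\<forall>v\<in>X. c' v \<noteq> c v \<longrightarrow>
      c v \<in> set (i # p) \<and> c' v \<in> set p \<and> Domainp r (c v) \<and> Rangep r (c' v)) \<and>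
    (\<forall>v\<in>X. c' v = i \<longrightarrow> c v = i)"
  using assms(1,2)
proof (induction rule: rtrancl_path.induct)
  case (base i)
  show ?case by (rule exI[of _ c]) (use assms in simp)
next
  case (step i i' p j)
  obtain c' where proper: "proper_coloring X k c'"
    and sizes: "add_mset i' (color_mset X c') = add_mset j (color_mset X c)"
    and changed: "\<And>v. v \<in> X \<Longrightarrow> c' v \<noteq> c v \<Longrightarrow>
      c v \<in> set (i' # p) \<and> c' v \<in> set p \<and> Domainp r (c v) \<and> Rangep r (c' v)"
    and class_i': "\<And>v. v \<in> X \<Longrightarrow> c' v = i' \<Longrightarrow> c v = i'"
    using step.IH step.prems by auto
  obtain w where w: "w \<in> X" "c w = i" and free: "i' \<in> free_colors X k c w"
    using movable[OF step.hyps(1)] unfolding movable_def color_class_def by blast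
  have "c' w = i"
    using changed[OF w(1)] w(2) step.prems by force
  have "i' \<in> free_colors X k c' w"
    using free class_i' by (auto simp: free_colors_iff)
  then have "proper_coloring X k (c'(w := i'))"
    by (rule proper_coloring_update[OF proper w(1)])
  moreover have "add_mset i (color_mset X (c'(w := i'))) = add_mset j (color_mset X c)"
    using color_mset_update[OF assms(3) w(1), of c' i'] \<open>c' w = i\<close> sizes by simp
  moreover have "c v \<in> set (i # i' # p) \<and> (c'(w := i')) v \<in> set (i' # p) \<and>
      Domainp r (c v) \<and> Rangep r ((c'(w := i')) v)" if "v \<in> X" "(c'(w := i')) v \<noteq> c v" for v
    using changed[OF that(1)] that(2) w(2) step.hyps(1) by (cases "v = w") auto
  moreover have "c v = i" if "v \<in> X" "(c'(w := i')) v = i" for v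
    using changed[OF that(1)] that(2) w(2) step.prems by (cases "v = w") force+
  ultimately show ?case by blast
qed

lemma shift_along_rtranclp:
  assumes "r\<^sup>*\<^sup>* i j" "finite X" "proper_coloring X k c" "\<And>a b. r a b \<Longrightarrow> movable X k c a b"
  obtains c' where "proper_coloring X k c'"
    "add_mset i (color_mset X c') = add_mset j (color_mset X c)"
    "\<And>v. v \<in> X \<Longrightarrow> c' v \<noteq> c v \<Longrightarrow> Domainp r (c v) \<and> Rangep r (c' v)"
    "\<And>v. v \<in> X \<Longrightarrow> c' v = i \<Longrightarrow> c v = i"
proof -
  obtain p where "rtrancl_path r i p j" "distinct (i # p)"
    using assms(1) rtrancl_path_distinct unfolding rtranclp_eq_rtrancl_path by metis
  from shift_along_path[OF this assms(2,3)] assms(4) that show thesis by meson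
qed

definition exchange :: "('a \<Rightarrow> nat) \<Rightarrow> 'a \<Rightarrow> 'a \<Rightarrow> 'a \<Rightarrow> nat \<Rightarrow> 'a \<Rightarrow> 'a \<Rightarrow> nat" where
  "exchange c y y' z i x = c(y := c z, y' := c z, z := i, x := c y')"

lemma color_mset_exchange:
  assumes "finite X" "x \<notin> X" "y \<in> X" "y' \<in> X" "z \<in> X" "distinct [y, y', z]"
  shows "add_mset (c y) (color_mset (insert x X) (exchange c y y' z i x)) =
    add_mset i (add_mset (c z) (color_mset X c))"
proof -
  have "add_mset (c y) (color_mset (insert x X) (exchange c y y' z i x)) =
      add_mset (c y) (add_mset (c y') (color_mset X (c(y := c z, y' := c z, z := i))))"
    using assms by (simp add: exchange_def color_mset_insert)
  also have "add_mset (c z) \<dots> =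
      add_mset (c y) (add_mset (c y') (add_mset i (color_mset X (c(y := c z, y' := c z)))))"
    using color_mset_update[of X z "c(y := c z, y' := c z)" i] assms by auto
  also have "\<dots> = add_mset (c y) (add_mset i (add_mset (c z) (color_mset X (c(y := c z)))))"
    using color_mset_update[of X y' "c(y := c z)" "c z"] assms by auto
  also have "\<dots> = add_mset i (add_mset (c z) (add_mset (c z) (color_mset X c)))"
    using color_mset_update[of X y c "c z"] assms by simp
  finally show ?thesis by simp
qed

lemma proper_coloring_exchange:
  assumes proper: "proper_coloring X k c"
    and y: "y \<in> X" "y' \<in> X" "y \<noteq> y'" "\<not> E y y'" and z: "z \<in> X"
    and solo: "solo (color_class X c (c z)) z y" "solo (color_class X c (c z)) z y'"
    and i: "i \<in> free_colors (X - {y}) k c z" "i \<noteq> c z"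
    and x: "c y' \<in> free_colors X k c x"
  shows "proper_coloring (insert x X) k (exchange c y y' z i x)"
proof -
  let ?W = "X - {z}" and ?c = "c(y := c z, y' := c z)"
  have "E z y" "E z y'"
    using solo soloD by blast+
  then have W: "y \<in> ?W" "y' \<in> ?W" and "i \<noteq> c y'"
    using y i by (auto simp: free_colors_iff)
  have "c y' \<noteq> c z"
    using proper y z \<open>E z y'\<close> unfolding proper_coloring_def by metis
  have only_z: "c u \<noteq> c z" if "u \<in> ?W" "E y u \<or> E y' u" for u
    using that solo solo_unique by (auto simp: color_class_def)
  have "c z < k"
    using proper z by (simp add: proper_coloring_def)
  have "proper_coloring ?W k c"
    using proper by (rule proper_coloring_subset) blast
  moreover have "c z \<in> free_colors ?W k c y"
    using only_z \<open>c z < k\<close> by (simp add: free_colors_iff)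
  ultimately have "proper_coloring ?W k (c(y := c z))"
    by (rule proper_coloring_update[OF _ W(1)])
  moreover have "c z \<in> free_colors ?W k (c(y := c z)) y'"
    using only_z \<open>c z < k\<close> \<open>\<not> E y y'\<close> edge_commute by (auto simp: free_colors_iff)
  ultimately have "proper_coloring ?W k ?c"
    by (rule proper_coloring_update[OF _ W(2)])
  then have "proper_coloring (insert z ?W) k (?c(z := i))"
    using i by (intro proper_coloring_insert) (auto simp: free_colors_iff)
  then have "proper_coloring X k (?c(z := i))"
    using z by (simp add: insert_absorb)
  moreover have "c y' \<in> free_colors X k (?c(z := i)) x"
    using x \<open>c y' \<noteq> c z\<close> \<open>i \<noteq> c y'\<close> by (auto simp: free_colors_iff)
  ultimately show ?thesis
    unfolding exchange_def by (rule proper_coloring_insert)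
qed

end

subsection \<open>A coloring that cannot be extended\<close>

locale stuck_coloring = undirected_graph E
  for E :: "'a \<Rightarrow> 'a \<Rightarrow> bool" +
  fixes X :: "'a set" and k :: nat and c :: "'a \<Rightarrow> nat" and x :: 'a and q :: nat
  assumes finite_X: "finite X" and x_notin_X: "x \<notin> X"
    and equitable: "equitable_coloring X E k c"
    and q_less: "q < k"
    and q_smallest: "\<And>j. j < k \<Longrightarrow> card (color_class X c q) \<le> card (color_class X c j)"
    and stuck: "\<not> (\<exists>c'. equitable_coloring (insert x X) E k c')"
begin

abbreviation Z :: "'a set" where
  "Z \<equiv> color_class X c q"

abbreviation free :: "'a \<Rightarrow> nat set" where
  "free \<equiv> free_colors X k c"

definition small :: "nat \<Rightarrow> bool" where
  "small j \<longleftrightarrow> j < k \<and> card (color_class X c j) = card Z"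

definition accessible :: "nat set" where
  "accessible = {i. \<exists>j. small j \<and> (movable X k c)\<^sup>*\<^sup>* i j}"

lemma proper: "proper_coloring X k c"
  using equitable equitable_coloring_iff finite_X by blast

lemma color_less: "v \<in> X \<Longrightarrow> c v < k"
  using proper by (simp add: proper_coloring_def)

lemma adjacent_color_neq: "u \<in> X \<Longrightarrow> v \<in> X \<Longrightarrow> E u v \<Longrightarrow> c u \<noteq> c v"
  using proper by (simp add: proper_coloring_def)

lemma finite_color_class: "finite (color_class X c j)"
  using finite_X by (simp add: color_class_def)

lemma card_color_class_bounds:
  assumes "j < k"
  shows "card Z \<le> card (color_class X c j)" "card (color_class X c j) \<le> card Z + 1"
  using q_smallest[OF assms] equitable q_less assms
  by (simp_all add: equitable_coloring_def color_class_def)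

lemma no_balanced_extension:
  assumes "proper_coloring (insert x X) k c'" "small j"
    and sizes: "color_mset (insert x X) c' = add_mset j (color_mset X c)"
  shows False
proof -
  have "card Z \<le> count (color_mset (insert x X) c') m \<and>
      count (color_mset (insert x X) c') m \<le> card Z + 1" if "m < k" for m
    using card_color_class_bounds[OF that] assms(2) finite_X
    by (auto simp: sizes count_color_mset small_def)
  then have "count (color_mset (insert x X) c') i \<le> count (color_mset (insert x X) c') m + 1"
    if "i < k" "m < k" for i m
    using that by (meson add_le_mono1 le_trans)
  then have "equitable_coloring (insert x X) E k c'"
    using assms(1) finite_X by (simp add: equitable_coloring_iff)
  with stuck show False by blast
qed

lemma small_q: "small q"
  using q_less by (simp add: small_def)

lemma q_accessible: "q \<in> accessible"
  using small_q by (auto simp: accessible_def)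

lemma accessible_subset: "accessible \<subseteq> {..<k}"
proof
  fix i assume "i \<in> accessible"
  then obtain j where "small j" "(movable X k c)\<^sup>*\<^sup>* i j"
    by (auto simp: accessible_def)
  from this(2,1) show "i \<in> {..<k}"
    by (cases rule: converse_rtranclpE)
      (auto simp: small_def movable_def color_class_def color_less)
qed

lemma finite_accessible: "finite accessible"
  using accessible_subset by (rule finite_subset) simp

lemma accessible_disjoint_free: "accessible \<inter> free x = {}"
proof (rule ccontr)
  assume "accessible \<inter> free x \<noteq> {}"
  then obtain i j where "i \<in> free x" "small j" and path: "(movable X k c)\<^sup>*\<^sup>* i j"
    by (auto simp: accessible_def)
  obtain c' where c': "proper_coloring X k c'" "\<And>v. v \<in> X \<Longrightarrow> c' v = i \<Longrightarrow> c v = i"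
    "add_mset i (color_mset X c') = add_mset j (color_mset X c)"
    using shift_along_rtranclp[OF path finite_X proper] by metis
  have "i \<in> free_colors X k c' x"
    using \<open>i \<in> free x\<close> c'(2) by (auto simp: free_colors_iff)
  with c'(1) have "proper_coloring (insert x X) k (c'(x := i))"
    by (rule proper_coloring_insert)
  moreover have "color_mset (insert x X) (c'(x := i)) = add_mset j (color_mset X c)"
    using color_mset_insert[OF finite_X x_notin_X] c'(3) by simp
  ultimately show False
    using no_balanced_extension \<open>small j\<close> by blast
qed

lemma accessible_disjoint_free_of_inaccessible:
  assumes "v \<in> X" "c v \<notin> accessible"
  shows "accessible \<inter> free v = {}"
proof (rule ccontr)
  assume "accessible \<inter> free v \<noteq> {}"
  then obtain i j where "i \<in> free v" "small j" "(movable X k c)\<^sup>*\<^sup>* i j"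
    by (auto simp: accessible_def)
  moreover from this have "movable X k c (c v) i"
    using assms(1) by (auto simp: movable_def color_class_def)
  ultimately have "c v \<in> accessible"
    unfolding accessible_def by (blast intro: converse_rtranclp_into_rtranclp)
  with assms(2) show False by blast
qed

lemma inaccessible_sees_Z:
  assumes "v \<in> X" "c v \<notin> accessible"
  shows "\<exists>w\<in>Z. E v w"
proof -
  have "q \<notin> free v"
    using accessible_disjoint_free_of_inaccessible[OF assms] q_accessible by blast
  then show ?thesis
    using q_less by (auto simp: free_colors_iff color_class_def)
qed

lemma card_accessible_le: "card accessible \<le> degree X E x"
proof -
  have "accessible \<subseteq> c ` {u \<in> X. E x u}"
    using accessible_disjoint_free accessible_subset by (auto simp: free_colors_def)
  then show ?thesis
    unfolding degree_def using finite_X by (intro surj_card_le) auto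
qed

lemma card_accessible_pos: "1 \<le> card accessible"
  using q_accessible finite_accessible by (auto simp: Suc_le_eq card_gt_0_iff)

lemma card_Z_pos: "0 < card Z"
proof -
  have "q \<notin> free x"
    using q_accessible accessible_disjoint_free by blast
  then have "Z \<noteq> {}"
    using q_less by (auto simp: free_colors_iff color_class_def)
  then show ?thesis
    using finite_color_class by (simp add: card_gt_0_iff)
qed

lemma free_subset_inaccessible: "free x \<subseteq> {..<k} - accessible"
  using accessible_disjoint_free by (auto simp: free_colors_def)

lemma card_colored_inaccessible:
  assumes "S \<subseteq> {..<k} - accessible"
  shows "card {v \<in> X. c v \<in> S} = card S * (card Z + 1)"
proof -
  have "card (color_class X c j) = card Z + 1" if "j \<in> S" for j
  proof -
    have "j < k" "\<not> small j"
      using that assms by (auto simp: accessible_def)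
    then show ?thesis
      using card_color_class_bounds[of j] by (simp add: small_def)
  qed
  moreover have "finite S"
    using assms by (rule finite_subset) simp
  ultimately show ?thesis
    by (simp add: card_colored_in finite_X)
qed

lemma solo_adjacent_after_recoloring:
  assumes c': "proper_coloring X k c'" "color_class X c' q = Z"
    and y: "y \<in> X" "y' \<in> X" "y \<noteq> y'" and solo: "solo Z z y" "solo Z z y'"
    and i: "i \<in> free_colors (X - {y}) k c' z" "i \<noteq> q"
    and x: "c' y' \<in> free_colors X k c' x"
    and sizes: "add_mset i (color_mset X c') = add_mset (c' y) (color_mset X c)"
  shows "E y y'"
proof (rule ccontr)
  assume "\<not> E y y'"
  have "z \<in> color_class X c' q"
    using solo soloD c'(2) by blast
  then have z: "z \<in> X" "c' z = q"
    by (auto simp: color_class_def)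
  let ?c = "exchange c' y y' z i x"
  have "proper_coloring (insert x X) k ?c"
    using c' y \<open>\<not> E y y'\<close> z solo i x by (intro proper_coloring_exchange) auto
  moreover have "color_mset (insert x X) ?c = add_mset q (color_mset X c)"
  proof -
    have "distinct [y, y', z]"
      using y(3) soloD[OF solo(1)] soloD[OF solo(2)] by auto
    then have "add_mset (c' y) (color_mset (insert x X) ?c) =
        add_mset i (add_mset q (color_mset X c'))"
      using color_mset_exchange[OF finite_X x_notin_X y(1,2) z(1), of c' i] z(2) by simp
    also have "\<dots> = add_mset (c' y) (add_mset q (color_mset X c))"
      using sizes by simp
    finally show ?thesis by simp
  qed
  ultimately show False
    using no_balanced_extension small_q by blast
qed

lemma private_solo_adjacent:
  assumes y: "y \<in> X" "solo Z z y" "c y \<in> free_colors (X - {y}) k c z"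
    and y': "y' \<in> X" "solo Z z y'" "c y' \<in> free x" and "y \<noteq> y'"
  shows "E y y'"
proof (rule solo_adjacent_after_recoloring[OF proper refl y(1) y'(1) \<open>y \<noteq> y'\<close> y(2) y'(2) y(3)])
  show "c y \<noteq> q"
    using adjacent_color_neq[of y z] y soloD[OF y(2)] by (auto simp: color_class_def)
qed (use y' in auto)

definition movable_free :: "nat \<Rightarrow> nat \<Rightarrow> bool" where
  "movable_free i j \<longleftrightarrow> i \<in> free x \<and> j \<in> free x \<and> movable X k c i j"

lemma solo_adjacent_of_avoiding_path:
  assumes y: "y \<in> X" "solo Z z y" "c y \<in> free x"
    and y': "y' \<in> X" "solo Z z y'" "c y' \<in> free x" and "y \<noteq> y'"
    and i: "i \<in> free x" "i \<in> free z"
    and path: "(\<lambda>a b. movable_free a b \<and> a \<notin> {c y, c y'})\<^sup>*\<^sup>* i (c y)"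
  shows "E y y'"
proof -
  obtain c' where c': "proper_coloring X k c'"
      "add_mset i (color_mset X c') = add_mset (c y) (color_mset X c)"
    and moved: "\<And>v. v \<in> X \<Longrightarrow> c' v \<noteq> c v \<Longrightarrow> c v \<in> free x - {c y, c y'} \<and> c' v \<in> free x"
    and class_i: "\<And>v. v \<in> X \<Longrightarrow> c' v = i \<Longrightarrow> c v = i"
    by (rule shift_along_rtranclp[OF path finite_X proper])
      (auto simp: movable_free_def Domainp_iff Rangep.simps)
  have "q \<notin> free x"
    using q_accessible accessible_disjoint_free by blast
  have fixed: "c' y = c y" "c' y' = c y'"
    using moved y(1) y'(1) by blast+
  have "free x \<subseteq> free_colors X k c' x"
    using moved by (fastforce simp: free_colors_iff)
  show ?thesis
  proof (rule solo_adjacent_after_recoloring[OF c'(1) _ y(1) y'(1) \<open>y \<noteq> y'\<close> y(2) y'(2)])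
    show "color_class X c' q = Z"
      using moved \<open>q \<notin> free x\<close> by (fastforce simp: color_class_def)
    show "i \<in> free_colors (X - {y}) k c' z"
      using i(2) class_i by (auto simp: free_colors_iff)
    show "i \<noteq> q"
      using i(1) \<open>q \<notin> free x\<close> by blast
    show "c' y' \<in> free_colors X k c' x"
      using \<open>free x \<subseteq> free_colors X k c' x\<close> fixed y'(3) by auto
  qed (use c'(2) fixed in simp)
qed

lemma reached_solo_adjacent:
  assumes y: "y \<in> X" "solo Z z y" "c y \<in> free x"
    and y': "y' \<in> X" "solo Z z y'" "c y' \<in> free x" and "y \<noteq> y'"
    and i: "i \<in> free x" "i \<in> free z" "movable_free\<^sup>*\<^sup>* i (c y)"
  shows "E y y'"
proof -
  \<comment> \<open>Stopping at the first of the two classes keeps both vertices in place during the shift.\<close>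
  obtain l where "l \<in> {c y, c y'}"
    "(\<lambda>a b. movable_free a b \<and> a \<notin> {c y, c y'})\<^sup>*\<^sup>* i l"
    using rtranclp_first_hit[OF i(3), of "{c y, c y'}"] by blast
  then consider (to_y) "(\<lambda>a b. movable_free a b \<and> a \<notin> {c y, c y'})\<^sup>*\<^sup>* i (c y)"
    | (to_y') "(\<lambda>a b. movable_free a b \<and> a \<notin> {c y', c y})\<^sup>*\<^sup>* i (c y')"
    by (auto simp: insert_commute)
  then show ?thesis
  proof cases
    case to_y
    then show ?thesis
      using solo_adjacent_of_avoiding_path[OF y y' \<open>y \<noteq> y'\<close> i(1,2)] by blast
  next
    case to_y'
    then have "E y' y"
      using solo_adjacent_of_avoiding_path[OF y' y _ i(1,2)] \<open>y \<noteq> y'\<close> by blast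
    then show ?thesis
      using edge_commute by blast
  qed
qed

definition solos :: "nat set \<Rightarrow> 'a \<Rightarrow> 'a set" where
  "solos S z = {v \<in> X. c v \<in> S \<and> solo Z z v}"

definition nonsolos :: "'a \<Rightarrow> 'a set" where
  "nonsolos z = {v \<in> X. c v \<in> free x \<and> E z v \<and> \<not> solo Z z v}"

definition in_closed :: "nat set \<Rightarrow> bool" where
  "in_closed S \<longleftrightarrow> S \<subseteq> free x \<and> (\<forall>i\<in>free x - S. \<forall>j\<in>S. \<not> movable X k c i j)"

definition reach :: "'a \<Rightarrow> nat set" where
  "reach z = {j. \<exists>i \<in> free x \<inter> free z. movable_free\<^sup>*\<^sup>* i j}"

lemma finite_solos: "finite (solos S z)" and finite_nonsolos: "finite (nonsolos z)"
  using finite_X by (simp_all add: solos_def nonsolos_def)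

lemma solos_subset: "solos S z \<subseteq> X"
  by (auto simp: solos_def)

lemma in_closed_Un: "in_closed S \<Longrightarrow> in_closed S' \<Longrightarrow> in_closed (S \<union> S')"
  by (auto simp: in_closed_def)

lemma reach_subset: "reach z \<subseteq> free x"
proof
  fix j assume "j \<in> reach z"
  then obtain i where "i \<in> free x" "movable_free\<^sup>*\<^sup>* i j"
    by (auto simp: reach_def)
  from this(2,1) show "j \<in> free x"
    by (cases rule: rtranclp.cases) (auto simp: movable_free_def)
qed

lemma in_closed_unreached: "in_closed (free x - reach z)"
proof -
  have "j \<in> reach z" if "i \<in> reach z" "j \<in> free x" "movable X k c i j" for i j
  proof -
    have "movable_free i j"
      using that reach_subset by (auto simp: movable_free_def)
    with that(1) show ?thesis
      by (auto simp: reach_def intro: rtranclp.rtrancl_into_rtrancl)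
  qed
  then show ?thesis
    by (auto simp: in_closed_def)
qed

lemma sum_excess_le:
  assumes "max_degree_le X E k"
  shows "(\<Sum>v\<in>{v \<in> X. c v \<notin> accessible}. degree Z E v - 1) \<le> card accessible * card Z"
proof -
  define B where "B = {v \<in> X. c v \<notin> accessible}"
  have fin: "finite B" "finite Z"
    using finite_X finite_color_class by (auto simp: B_def)
  have "B = {v \<in> X. c v \<in> {..<k} - accessible}"
    using color_less by (auto simp: B_def)
  then have card_B: "card B = (k - card accessible) * (card Z + 1)"
    using card_colored_inaccessible[OF subset_refl] accessible_subset finite_accessible
    by (simp add: card_Diff_subset)
  have "card accessible \<le> k"
    using card_mono[OF _ accessible_subset] by simp
  then have split_k: "k * card Z = card accessible * card Z + (k - card accessible) * card Z"
    by (simp flip: distrib_right)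
  have "1 \<le> degree Z E v" if "v \<in> B" for v
    using that one_le_degree_iff[OF fin(2)] inaccessible_sees_Z unfolding B_def by blast
  then have "(\<Sum>v\<in>B. degree Z E v - 1) = (\<Sum>v\<in>B. degree Z E v) - card B"
    by (simp add: sum_subtractf_nat)
  moreover have "(\<Sum>v\<in>B. degree Z E v) = (\<Sum>w\<in>Z. degree B E w)"
    unfolding degree_def using fin(2,1)
    by (intro sum_multicount_gen[symmetric]) (simp_all add: edge_commute)
  moreover have "(\<Sum>w\<in>Z. degree B E w) \<le> (\<Sum>w\<in>Z. k)"
  proof (rule sum_mono)
    fix w assume "w \<in> Z"
    have "degree B E w \<le> degree X E w"
      using finite_X by (intro degree_mono) (auto simp: B_def)
    also have "\<dots> \<le> k"
      using assms \<open>w \<in> Z\<close> by (auto simp: max_degree_le_def color_class_def)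
    finally show "degree B E w \<le> k" .
  qed
  ultimately have "(\<Sum>v\<in>B. degree Z E v - 1) \<le> k * card Z - card B"
    by (simp add: mult.commute)
  also have "\<dots> \<le> card accessible * card Z"
    unfolding card_B by (subst split_k) simp
  finally show ?thesis
    by (simp add: B_def)
qed

lemma sum_excess_free_le:
  assumes "max_degree_le X E k" "S \<subseteq> free x"
  shows "(\<Sum>v\<in>{v \<in> X. c v \<in> S}. degree Z E v - 1) \<le> card accessible * card Z"
proof -
  have "(\<Sum>v\<in>{v \<in> X. c v \<in> S}. degree Z E v - 1) \<le>
      (\<Sum>v\<in>{v \<in> X. c v \<notin> accessible}. degree Z E v - 1)"
    using assms(2) accessible_disjoint_free finite_X by (intro sum_mono2) auto
  then show ?thesis
    using sum_excess_le[OF assms(1)] by linarith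
qed

lemma sum_solos_ge:
  assumes "max_degree_le X E k" "S \<subseteq> free x"
  shows "card S * card Z \<le> (\<Sum>z\<in>Z. card (solos S z)) + card accessible * card Z"
proof -
  have "card S * card Z \<le> card {v \<in> X. c v \<in> S}"
    using assms(2) free_subset_inaccessible by (subst card_colored_inaccessible) auto
  also have "\<dots> \<le> (\<Sum>z\<in>Z. card {v \<in> {v \<in> X. c v \<in> S}. solo Z z v}) +
      (\<Sum>v\<in>{v \<in> X. c v \<in> S}. degree Z E v - 1)"
    using finite_X assms(2) accessible_disjoint_free inaccessible_sees_Z
    by (intro card_le_sum_solo finite_color_class) auto
  also have "\<dots> \<le> (\<Sum>z\<in>Z. card (solos S z)) + card accessible * card Z"
    using sum_excess_free_le[OF assms] by (simp add: solos_def conj_assoc)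
  finally show ?thesis .
qed

lemma sum_nonsolos_le:
  assumes "max_degree_le X E k"
  shows "(\<Sum>z\<in>Z. card (nonsolos z)) \<le> 2 * (card accessible * card Z)"
proof -
  have "(\<Sum>z\<in>Z. card (nonsolos z)) \<le> 2 * (\<Sum>v\<in>{v \<in> X. c v \<in> free x}. degree Z E v - 1)"
    using sum_nonsolo_le[OF finite_color_class, of "{v \<in> X. c v \<in> free x}" q] finite_X
    by (simp add: nonsolos_def conj_assoc)
  also have "\<dots> \<le> 2 * (card accessible * card Z)"
    using sum_excess_free_le[OF assms subset_refl] by simp
  finally show ?thesis .
qed

lemma exists_center:
  fixes d :: nat and a :: real
  assumes "max_degree_le X E k" "S \<subseteq> free x"
  defines "a \<equiv> real (card accessible)"
  shows "\<exists>z\<in>Z. a * (card S - a - 2 * real d) \<le> a * card (solos S z) - real d * card (nonsolos z)"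
proof (rule ccontr)
  define gain where "gain z = a * card (solos S z) - real d * card (nonsolos z)" for z
  assume "\<not> ?thesis"
  then have "(\<Sum>z\<in>Z. gain z) < card Z * (a * (card S - a - 2 * real d))"
    using card_Z_pos by (intro sum_bounded_above_strict) (auto simp: gain_def not_le)
  moreover have "(\<Sum>z\<in>Z. gain z) =
      a * real (\<Sum>z\<in>Z. card (solos S z)) - d * real (\<Sum>z\<in>Z. card (nonsolos z))"
    by (simp add: gain_def sum_subtractf sum_distrib_left)
  moreover have "a * (card S * card Z) \<le> a * (real (\<Sum>z\<in>Z. card (solos S z)) + a * card Z)"
  proof (rule mult_left_mono)
    show "real (card S * card Z) \<le> real (\<Sum>z\<in>Z. card (solos S z)) + a * card Z"
      using sum_solos_ge[OF assms(1,2)] unfolding a_def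
      by (simp only: of_nat_add[symmetric] of_nat_mult[symmetric] of_nat_le_iff)
  qed (simp add: a_def)
  moreover have "d * real (\<Sum>z\<in>Z. card (nonsolos z)) \<le> d * (2 * (a * card Z))"
  proof (rule mult_left_mono)
    have "real (\<Sum>z\<in>Z. card (nonsolos z)) \<le> real (2 * (card accessible * card Z))"
      using sum_nonsolos_le[OF assms(1)] by (simp only: of_nat_le_iff)
    then show "real (\<Sum>z\<in>Z. card (nonsolos z)) \<le> 2 * (a * card Z)"
      by (simp add: a_def)
  qed simp
  ultimately show False
    by (simp add: algebra_simps)
qed

end

subsection \<open>Coloring degenerate graphs of small maximum degree\<close>

lemma closed_size_dichotomy:
  fixes a d f p :: real
  assumes "1 \<le> a" "a \<le> d" "5.21 * d \<le> f" "p * (f - p) + a * f \<le> d * (f + a)"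
  defines "T \<equiv> 1.36 * d - 1.15 * a"
  shows "p \<le> T \<or> f - p \<le> T"
proof (rule ccontr)
  assume "\<not> ?thesis"
  then have "0 < (p - T) * (f - p - T)"
    by simp
  then have "T * (f - T) < p * (f - p)"
    by (simp add: algebra_simps)
  moreover have "d * (f + a) - a * f \<le> T * (f - T)"
  proof -
    have "(T - (d - a)) * (f - 5.21 * d) \<ge> 0"
      using assms by (intro mult_nonneg_nonneg) (auto simp: T_def)
    moreover have "0 \<le> 260 * (d * d) + 13465 * (a * d) - 13225 * (a * a)"
    proof -
      have "a * a \<le> a * d"
        using assms by (intro mult_left_mono) auto
      moreover have "0 \<le> d * d" "0 \<le> a * a"
        by simp_all
      ultimately show ?thesis by linarith
    qed
    ultimately show ?thesis
      unfolding T_def by (simp add: algebra_simps)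
  qed
  ultimately show False
    using assms(4) by linarith
qed

lemma few_nonsolos_contradiction:
  fixes a d f u :: real
  defines "T \<equiv> 1.36 * d - 1.15 * a"
  assumes "1 \<le> a" "a \<le> d" "5.21 * d \<le> f" "f - 2 * T - 2 * d \<le> u"
    and "(a + d) * u \<le> a * (3 * d + T + a)"
  shows False
proof -
  have "(a + d) * (0.49 * d + 2.3 * a) \<le> (a + d) * u"
    using assms by (intro mult_left_mono) auto
  also have "\<dots> \<le> a * (4.36 * d - 0.15 * a)"
    using assms(6) by (simp add: T_def)
  finally have "(a + d) * (0.49 * d + 2.3 * a) - a * (4.36 * d - 0.15 * a) \<le> 0"
    by simp
  moreover have "(a + d) * (0.49 * d + 2.3 * a) - a * (4.36 * d - 0.15 * a) =
      0.49 * (d * d) - 1.57 * (a * d) + 2.45 * (a * a)"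
    by (simp add: field_simps)
  ultimately have "0.49 * (d * d) - 1.57 * (a * d) + 2.45 * (a * a) \<le> 0"
    by linarith
  moreover have "0 \<le> (d - 2 * a) * (d - 2 * a)"
    by simp
  moreover have "0 < a * a" "0 < a * d" "0 < d * d"
    using assms by simp_all
  ultimately show False
    by (simp add: algebra_simps)
qed

locale stuck_degenerate_coloring = stuck_coloring E X k c x q
  for E :: "'a \<Rightarrow> 'a \<Rightarrow> bool" and X :: "'a set" and k :: nat and c :: "'a \<Rightarrow> nat" and x :: 'a
    and q :: nat +
  fixes d :: nat
  assumes d_pos: "1 \<le> d" and k_ge: "6.21 * real d \<le> real k"
    and max_degree: "max_degree_le X E k"
    and degenerate: "degenerate d X E"
    and degree_x: "degree X E x \<le> d"
begin

abbreviation num_accessible :: real where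
  "num_accessible \<equiv> real (card accessible)"

abbreviation num_free :: real where
  "num_free \<equiv> real (card (free x))"

definition threshold :: real where
  "threshold = 1.36 * real d - 1.15 * num_accessible"

definition core :: "nat set" where
  "core = \<Union> {S. in_closed S \<and> real (card S) \<le> threshold}"

definition crossing_pairs :: "nat set \<Rightarrow> ('a \<times> nat) set" where
  "crossing_pairs S =
    {v \<in> X. c v \<in> free x} \<times> accessible \<union> {v \<in> X. c v \<in> free x - S} \<times> S"

definition private_solos :: "'a \<Rightarrow> 'a set" where
  "private_solos z = {v \<in> solos (free x) z. c v \<in> free_colors (X - {v}) k c z}"

lemma num_accessible_bounds: "1 \<le> num_accessible" "num_accessible \<le> d"
  using card_accessible_pos card_accessible_le degree_x by simp_all

lemma num_free_ge: "real k - d \<le> num_free"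
  using card_free_colors_ge[OF finite_X, of k c x] degree_x by simp

lemma num_free_ge_5_21: "5.21 * d \<le> num_free"
  using num_free_ge k_ge by simp

lemma threshold_bounds: "0 \<le> threshold" "3 * threshold < num_free"
  using num_accessible_bounds num_free_ge_5_21 by (simp_all add: threshold_def)

lemma num_free_margin: "d + 1 < num_free - threshold - num_accessible - 2 * real d"
proof (cases "d = 1")
  case True
  then have "7 \<le> k"
    using k_ge by simp
  then show ?thesis
    unfolding threshold_def using True num_accessible_bounds num_free_ge by simp
next
  case False
  then have "2 \<le> real d"
    using d_pos by simp
  then show ?thesis
    using num_accessible_bounds num_free_ge_5_21 by (simp add: threshold_def)
qed

lemma card_crossing_pairs:
  assumes "S \<subseteq> free x"
  shows "card (crossing_pairs S) =
    (card S * (card (free x) - card S) + card accessible * card (free x)) * (card Z + 1)"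
proof -
  have "finite S"
    using assms finite_free_colors by (rule finite_subset)
  have "card (crossing_pairs S) = card {v \<in> X. c v \<in> free x} * card accessible
      + card {v \<in> X. c v \<in> free x - S} * card S"
    unfolding crossing_pairs_def
    using finite_X finite_accessible \<open>finite S\<close> assms accessible_disjoint_free
    by (subst card_Un_disjoint) (auto simp: card_cartesian_product)
  also have "\<dots> = card (free x) * (card Z + 1) * card accessible
      + card (free x - S) * (card Z + 1) * card S"
    using free_subset_inaccessible card_colored_inaccessible[of "free x"]
      card_colored_inaccessible[of "free x - S"] by auto
  finally show ?thesis
    using assms \<open>finite S\<close> by (simp add: card_Diff_subset algebra_simps)
qed

lemma crossing_pair_seen:
  assumes "in_closed S" "(u, j) \<in> crossing_pairs S"
  shows "\<exists>v\<in>X. c v \<in> free x \<union> accessible \<and> E u v \<and> c v = j"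
proof -
  have "u \<in> X" "c u \<notin> accessible" and j: "j \<in> free x \<union> accessible"
    using assms accessible_disjoint_free by (auto simp: crossing_pairs_def in_closed_def)
  have "j \<notin> free u"
  proof (cases "j \<in> accessible")
    case True
    then show ?thesis
      using accessible_disjoint_free_of_inaccessible \<open>u \<in> X\<close> \<open>c u \<notin> accessible\<close> by blast
  next
    case False
    then show ?thesis
      using assms by (auto simp: crossing_pairs_def in_closed_def movable_def color_class_def)
  qed
  moreover have "j < k"
    using j accessible_subset by (auto simp: free_colors_iff)
  ultimately show ?thesis
    using j by (auto simp: free_colors_iff)
qed

lemma card_colored_free_or_accessible_le:
  "card {v \<in> X. c v \<in> free x \<union> accessible} \<le>
    (card (free x) + card accessible) * (card Z + 1)"
proof -
  have "card {v \<in> X. c v \<in> free x \<union> accessible} =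
      (\<Sum>j\<in>free x \<union> accessible. card (color_class X c j))"
    using finite_X finite_free_colors finite_accessible by (intro card_colored_in) auto
  also have "\<dots> \<le> (\<Sum>j\<in>free x \<union> accessible. card Z + 1)"
    using accessible_subset
    by (intro sum_mono card_color_class_bounds) (auto simp: free_colors_iff)
  also have "\<dots> = (card (free x) + card accessible) * (card Z + 1)"
    using card_Un_disjoint[OF finite_free_colors finite_accessible] accessible_disjoint_free
    by (simp add: Int_commute)
  finally show ?thesis .
qed

lemma card_in_closed_le:
  assumes "in_closed S"
  shows "card S * (card (free x) - card S) + card accessible * card (free x)
    \<le> d * (card (free x) + card accessible)"
proof -
  let ?W = "{v \<in> X. c v \<in> free x \<union> accessible}"
    and ?pairs = "card S * (card (free x) - card S) + card accessible * card (free x)"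
  have S: "S \<subseteq> free x"
    using assms by (simp add: in_closed_def)
  have "?pairs * (card Z + 1) = card (crossing_pairs S)"
    using card_crossing_pairs[OF S] by simp
  also have "\<dots> \<le> d * card ?W"
  proof (rule card_seen_colors_le)
    show "finite ?W" "degenerate d ?W E"
      using finite_X degenerate_subset[OF degenerate] by auto
    show "u \<in> ?W \<and> (\<exists>v\<in>?W. E u v \<and> c v = j)" if "(u, j) \<in> crossing_pairs S" for u j
      using that crossing_pair_seen[OF assms that] by (auto simp: crossing_pairs_def)
    show "(v, c u) \<notin> crossing_pairs S" if "(u, c v) \<in> crossing_pairs S" for u v
      using that S accessible_disjoint_free by (auto simp: crossing_pairs_def)
  qed
  also have "\<dots> \<le> d * ((card (free x) + card accessible) * (card Z + 1))"
    using card_colored_free_or_accessible_le by (rule mult_le_mono2)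
  finally have "?pairs * (card Z + 1) \<le> d * (card (free x) + card accessible) * (card Z + 1)"
    by (simp only: mult.assoc)
  then show ?thesis
    by (metis add_gr_0 less_one mult_le_cancel2)
qed

lemma in_closed_small_or_cosmall:
  assumes "in_closed S"
  shows "card S \<le> threshold \<or> num_free - card S \<le> threshold"
proof -
  have "card S \<le> card (free x)"
    using assms finite_free_colors by (auto simp: in_closed_def intro: card_mono)
  moreover have "real (card S * (card (free x) - card S) + card accessible * card (free x))
      \<le> real (d * (card (free x) + card accessible))"
    using card_in_closed_le[OF assms] by (simp only: of_nat_le_iff)
  ultimately have "card S * (num_free - card S) + num_accessible * num_free
      \<le> d * (num_free + num_accessible)"
    by (simp add: of_nat_diff)
  then show ?thesis
    using closed_size_dichotomy[OF num_accessible_bounds num_free_ge_5_21]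
    by (simp add: threshold_def)
qed

lemma in_closed_core: "in_closed core" and card_core_le: "card core \<le> threshold"
proof -
  let ?small = "{S. in_closed S \<and> real (card S) \<le> threshold}"
  have "\<Union> ?small \<in> ?small"
  proof (rule finite_Sup_in)
    show "finite ?small"
      using finite_free_colors[of X k c x]
      by (rule finite_subset[rotated, OF finite_Pow_iff[THEN iffD2]]) (auto simp: in_closed_def)
    have "in_closed {}"
      by (simp add: in_closed_def)
    then show "?small \<noteq> {}"
      using threshold_bounds(1) by force
    fix S S' assume "S \<in> ?small" "S' \<in> ?small"
    then have small: "in_closed S" "in_closed S'" "card S \<le> threshold" "card S' \<le> threshold"
      by simp_all
    have "real (card (S \<union> S')) \<le> real (card S) + real (card S')"
      using card_Un_le[of S S'] by linarith
    then have "card (S \<union> S') \<le> threshold"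
      using in_closed_small_or_cosmall[OF in_closed_Un[OF small(1,2)]] small(3,4)
        threshold_bounds(2) by linarith
    then show "S \<union> S' \<in> ?small"
      using in_closed_Un[OF small(1,2)] by simp
  qed
  then show "in_closed core" "card core \<le> threshold"
    by (simp_all add: core_def)
qed

lemma card_free_minus_core_ge: "num_free - threshold \<le> card (free x - core)"
proof -
  have "real (card (free x)) - real (card core) \<le> card (free x - core)"
    using diff_card_le_card_Diff[of core "free x"] in_closed_core finite_free_colors
    by (auto simp: in_closed_def dest: finite_subset)
  then show ?thesis
    using card_core_le by linarith
qed

lemma solos_minus_core_le:
  assumes "card (free x - reach z) \<le> threshold"
  shows "card (solos (free x - core) z) \<le> d + 1"
proof (rule card_clique_le[OF finite_solos degenerate_subset[OF degenerate solos_subset]])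
  have "free x - reach z \<subseteq> core"
    using assms in_closed_unreached by (auto simp: core_def)
  fix v v' assume v: "v \<in> solos (free x - core) z" "v' \<in> solos (free x - core) z" "v \<noteq> v'"
  then have "c v \<in> reach z"
    using \<open>free x - reach z \<subseteq> core\<close> by (auto simp: solos_def)
  then obtain i where "i \<in> free x" "i \<in> free z" "movable_free\<^sup>*\<^sup>* i (c v)"
    by (auto simp: reach_def)
  then show "E v v'"
    using v reached_solo_adjacent[of v z v' i] by (auto simp: solos_def)
qed

lemma card_private_solos_le:
  assumes "d + 1 < card (solos (free x) z)"
  shows "card (private_solos z) \<le> d"
proof (rule card_universal_vertices_le)
  show "finite (solos (free x) z)" "degenerate d (solos (free x) z) E"
    using finite_solos degenerate_subset[OF degenerate solos_subset] by auto
  show "E u v" if "u \<in> private_solos z" "v \<in> solos (free x) z" "u \<noteq> v" for u v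
    using that private_solo_adjacent[of u z v] by (auto simp: private_solos_def solos_def)
qed (use assms in \<open>auto simp: private_solos_def\<close>)

lemma two_le_hit_color_weight:
  assumes "j \<in> free x - free z"
  shows "2 \<le> card (color_class {v \<in> X. E z v} c j)
    + (card (color_class (private_solos z) c j) + card (color_class (nonsolos z) c j))"
proof -
  let ?N = "color_class {v \<in> X. E z v} c j"
  have finite_N: "finite ?N"
    using finite_X by (simp add: color_class_def)
  obtain u where u: "u \<in> ?N"
    using assms by (auto simp: free_colors_iff color_class_def)
  show ?thesis
  proof (cases "?N = {u}")
    case True
    have "j < k" "\<forall>v\<in>X - {u}. E z v \<longrightarrow> c v \<noteq> j"
      using assms True by (auto simp: free_colors_iff color_class_def)
    then have "u \<in> color_class (private_solos z) c j \<union> color_class (nonsolos z) c j"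
      using u assms
      by (auto simp: private_solos_def nonsolos_def solos_def free_colors_iff color_class_def)
    then have "1 \<le> card (color_class (private_solos z) c j \<union> color_class (nonsolos z) c j)"
      using finite_solos finite_nonsolos
      by (auto simp: Suc_le_eq card_gt_0_iff private_solos_def color_class_def)
    also have "\<dots> \<le> card (color_class (private_solos z) c j) + card (color_class (nonsolos z) c j)"
      by (rule card_Un_le)
    finally show ?thesis
      using True by simp
  next
    case False
    then obtain u' where "u' \<in> ?N" "u' \<noteq> u"
      using u by blast
    then have "card {u, u'} \<le> card ?N"
      using u by (intro card_mono finite_N) auto
    then show ?thesis
      using \<open>u' \<noteq> u\<close> by simp
  qed
qed

lemma card_hit_colors_le:
  "2 * card (free x - free z) \<le> degree X E z + (card (private_solos z) + card (nonsolos z))"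
proof -
  let ?H = "free x - free z"
  have fibres: "(\<Sum>j\<in>?H. card (color_class Y c j)) \<le> card Y" if "finite Y" for Y
    using that finite_free_colors card_colored_in[of Y ?H c]
    by (metis (no_types, lifting) card_mono finite_Diff mem_Collect_eq subsetI)
  have "2 * card ?H \<le> (\<Sum>j\<in>?H. card (color_class {v \<in> X. E z v} c j)
      + (card (color_class (private_solos z) c j) + card (color_class (nonsolos z) c j)))"
    using sum_mono[of ?H "\<lambda>_. 2", OF two_le_hit_color_weight] by (simp add: mult.commute)
  also have "\<dots> \<le> degree X E z + (card (private_solos z) + card (nonsolos z))"
    unfolding sum.distrib degree_def
    using finite_X finite_nonsolos finite_solos
    by (intro add_mono fibres) (auto simp: private_solos_def)
  finally show ?thesis .
qed

lemma card_nonsolos_ge: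
  assumes z: "z \<in> Z" and many: "d + 1 < card (solos (free x) z)"
    and reach: "card (reach z) \<le> threshold"
  shows "num_free - 2 * threshold - 2 * d \<le> card (nonsolos z)"
proof -
  have "free x \<inter> free z \<subseteq> reach z"
    by (auto simp: reach_def)
  then have "card (free x \<inter> free z) \<le> card (reach z)"
    using finite_subset[OF reach_subset finite_free_colors] by (intro card_mono) auto
  moreover have "card (free x) = card (free x - free z) + card (free x \<inter> free z)"
    using finite_free_colors by (metis Int_commute card_Int_Diff add.commute)
  moreover have "degree X E z \<le> k"
    using max_degree z by (auto simp: max_degree_le_def color_class_def)
  ultimately have "2 * card (free x) \<le> k + d + card (nonsolos z) + 2 * card (reach z)"
    using card_hit_colors_le[of z] card_private_solos_le[OF many] by linarith
  then have "2 * num_free \<le> real k + d + card (nonsolos z) + 2 * real (card (reach z))"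
    by linarith
  then show ?thesis
    using num_free_ge reach by linarith
qed

lemma card_solos_nonsolos_le:
  assumes "z \<in> Z" "S \<subseteq> free x"
  shows "card (solos S z) + card (nonsolos z) \<le> k"
proof -
  have "card (solos S z) + card (nonsolos z) = card (solos S z \<union> nonsolos z)"
    using finite_solos finite_nonsolos
    by (intro card_Un_disjoint[symmetric]) (auto simp: solos_def nonsolos_def)
  also have "\<dots> \<le> degree X E z"
    unfolding degree_def using finite_X soloD
    by (intro card_mono) (auto simp: solos_def nonsolos_def)
  also have "\<dots> \<le> k"
    using max_degree assms(1) by (auto simp: max_degree_le_def color_class_def)
  finally show ?thesis .
qed

lemma exists_center_with_many_solos:
  obtains z where "z \<in> Z" "d + 1 < card (solos (free x - core) z)"
    "(num_accessible + d) * card (nonsolos z) \<le> num_accessible * (3 * d + threshold + num_accessible)"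
proof -
  obtain z where z: "z \<in> Z"
    and center: "num_accessible * (card (free x - core) - num_accessible - 2 * real d)
      \<le> num_accessible * card (solos (free x - core) z) - real d * card (nonsolos z)"
    using exists_center[OF max_degree, of "free x - core" d] by auto
  let ?y = "real (card (solos (free x - core) z))" and ?u = "real (card (nonsolos z))"
  have "num_accessible * (num_free - threshold - num_accessible - 2 * real d)
      \<le> num_accessible * (card (free x - core) - num_accessible - 2 * real d)"
    using card_free_minus_core_ge by (intro mult_left_mono) auto
  with center have weight: "num_accessible * (num_free - threshold - num_accessible - 2 * real d)
      \<le> num_accessible * ?y - d * ?u"
    by linarith
  moreover have "0 \<le> d * ?u"
    by simp
  ultimately have "num_accessible * (num_free - threshold - num_accessible - 2 * real d)
      \<le> num_accessible * ?y"
    by linarith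
  then have "num_free - threshold - num_accessible - 2 * real d \<le> ?y"
    using num_accessible_bounds by simp
  then have "d + 1 < card (solos (free x - core) z)"
    using num_free_margin by linarith
  moreover have "(num_accessible + d) * ?u \<le> num_accessible * (3 * d + threshold + num_accessible)"
  proof -
    have "?y + ?u \<le> num_free + d"
      using card_solos_nonsolos_le[OF z, of "free x - core"] num_free_ge by simp
    then have "num_accessible * (?y + ?u) \<le> num_accessible * (num_free + d)"
      by (intro mult_left_mono) auto
    with weight show ?thesis
      by (simp add: algebra_simps)
  qed
  ultimately show thesis
    using that z by blast
qed

lemma not_stuck: False
proof -
  obtain z where z: "z \<in> Z" and many: "d + 1 < card (solos (free x - core) z)"
    and few: "(num_accessible + d) * card (nonsolos z)
      \<le> num_accessible * (3 * d + threshold + num_accessible)"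
    by (rule exists_center_with_many_solos)
  from in_closed_small_or_cosmall[OF in_closed_unreached[of z]] show False
  proof
    assume "card (free x - reach z) \<le> threshold"
    then show False
      using solos_minus_core_le[of z] many by simp
  next
    assume "num_free - card (free x - reach z) \<le> threshold"
    moreover have "card (free x) = card (free x - reach z) + card (reach z)"
      using reach_subset finite_free_colors
      by (metis card_Int_Diff add.commute inf.absorb_iff2)
    ultimately have "card (reach z) \<le> threshold"
      by simp
    moreover have "d + 1 < card (solos (free x) z)"
      using many by (rule less_le_trans) (auto simp: solos_def finite_X intro!: card_mono)
    ultimately have "num_free - 2 * threshold - 2 * d \<le> card (nonsolos z)"
      using card_nonsolos_ge[OF z] by blast
    then show False
      using few few_nonsolos_contradiction[OF num_accessible_bounds num_free_ge_5_21]
      by (simp add: threshold_def)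
  qed
qed

end

lemma (in undirected_graph) equitable_coloring_insert:
  assumes "1 \<le> d" "6.21 * real d \<le> real k" "finite X" "x \<notin> X"
    and "max_degree_le X E k" "degenerate d X E" "degree X E x \<le> d"
    and "equitable_coloring X E k c"
  shows "\<exists>c'. equitable_coloring (insert x X) E k c'"
proof (rule ccontr)
  assume stuck: "\<not> ?thesis"
  have "0 < k"
    using assms(1,2) by (cases k) auto
  then obtain q where "q < k" "\<And>j. j < k \<Longrightarrow> card (color_class X c q) \<le> card (color_class X c j)"
    using ex_has_least_nat[of "\<lambda>j. j < k" 0 "\<lambda>j. card (color_class X c j)"] by blast
  then interpret stuck_degenerate_coloring E X k c x q d
    using assms stuck by unfold_locales auto
  show False
    by (rule not_stuck)
qed

theorem theorem3:
  fixes V :: "'a set" and E :: "'a \<Rightarrow> 'a \<Rightarrow> bool" and d D :: nat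
  assumes "d \<ge> 1"
    and "real D \<ge> 6.21 * real d"
    and "simple_graph V E"
    and "degenerate d V E"
    and "max_degree_le V E D"
  shows "\<exists>c. equitable_coloring V E D c"
proof -
  interpret undirected_graph E
    using assms(3) by unfold_locales (auto simp: simple_graph_def symp_def irreflp_def)
  have "finite V"
    using assms(3) by (simp add: simple_graph_def)
  then show ?thesis
    using assms(4,5)
  proof (induction rule: degenerate_induct)
    case empty
    show ?case by (simp add: equitable_coloring_def)
  next
    case (insert X x)
    then have "max_degree_le X E D"
      using max_degree_le_subset by blast
    then show ?case
      using insert equitable_coloring_insert[OF assms(1,2)] by blast
  qed
qed

end
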